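(* Let $z$ be an indeterminate (treated as a scalar) and let $A=\{a,b_0,b_1,b_2,\dots\}$ be an alphabet. For each $k\ge 1$ let $G_k$ be the context-free grammar $$G_k=\{a\to (k-1)(k-1+z)a,\ b_0\to b_1,\ b_1\to b_2,\ \dots,\ b_{k-1}\to b_k\},$$ and let $D_k$ be the formal derivative associated with $G_k$. Then for every $n\ge 1$, $$D_nD_{n-1}\cdots D_1(ab_0)=a\sum_{k=1}^n \mathrm{Jc}_n^k(z)\,b_k.$$
   Context: A context-free grammar $G$ over an alphabet $A$ assigns to each letter of $A$ an element of the ring $\mathbb{Q}[z][[A]]$ of formal power series in the letters of $A$ (with scalars polynomials in $z$). The formal derivative $D=D_G$ is the unique $\mathbb{Q}[z]$-linear derivation (satisfying the Leibniz rule on products) with $D(x)=G(x)$ for each letter $x$; letters without a rule in $G$ (here $b_j$ for $j\ge k$ in $G_k$) are mapped to $0$. The unsigned Jacobi-Stirling numbers of the first kind $\mathrm{Jc}_n^k(z)$ are defined by $\prod_{i=0}^{n-1}(x+i(z+i))=\sum_{k=0}^n\mathrm{Jc}_n^k(z)x^k$; equivalently, $\mathrm{Jc}_n^k(z)=\mathrm{Jc}_{n-1}^{k-1}(z)+(n-1)(n-1+z)\mathrm{Jc}_{n-1}^k(z)$ with $\mathrm{Jc}_n^0(z)=\delta_{n,0}$ and $\mathrm{Jc}_0^k(z)=\delta_{k,0}$. *)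

theory Defs
  imports
    "HOL-Library.Multiset"
    "HOL-Computational_Algebra.Polynomial"
begin

section \<open>Formal power series in commuting letters\<close>

text \<open>
  A monomial over an alphabet \<open>'x\<close> is a finite multiset of letters (multiplication of monomials is
  multiset sum).  The type \<open>('x, 'r) mfps\<close> is the ring \<open>'r[['x]]\<close>: arbitrary coefficient functions
  on monomials with convolution as product.  Every monomial has only finitely many factorisations,
  so this makes sense for infinite alphabets.
\<close>

typedef ('x, 'r) mfps = "UNIV :: ('x multiset \<Rightarrow> 'r) set"
  morphisms mfps_nth Abs_mfps
  by simp

lemma mfps_nth_Abs [simp]: "mfps_nth (Abs_mfps f) = f"
  by (simp add: Abs_mfps_inverse)

lemma mfps_ext: "(\<And>m. mfps_nth f m = mfps_nth g m) \<Longrightarrow> f = g"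
  by (simp add: mfps_nth_inject [symmetric] fun_eq_iff)

lemma mfps_eq_iff: "f = g \<longleftrightarrow> (\<forall>m. mfps_nth f m = mfps_nth g m)"
  by (auto intro: mfps_ext)

definition msplits :: "'x multiset \<Rightarrow> ('x multiset \<times> 'x multiset) set" where
  "msplits m = {(p, q). p + q = m}"

instantiation mfps :: (type, comm_ring_1) comm_ring_1
begin

definition zero_mfps :: "('a, 'b) mfps" where
  "0 = Abs_mfps (\<lambda>m. 0)"

definition one_mfps :: "('a, 'b) mfps" where
  "1 = Abs_mfps (\<lambda>m. if m = {#} then 1 else 0)"

definition plus_mfps :: "('a, 'b) mfps \<Rightarrow> ('a, 'b) mfps \<Rightarrow> ('a, 'b) mfps" where
  "f + g = Abs_mfps (\<lambda>m. mfps_nth f m + mfps_nth g m)"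

definition minus_mfps :: "('a, 'b) mfps \<Rightarrow> ('a, 'b) mfps \<Rightarrow> ('a, 'b) mfps" where
  "f - g = Abs_mfps (\<lambda>m. mfps_nth f m - mfps_nth g m)"

definition uminus_mfps :: "('a, 'b) mfps \<Rightarrow> ('a, 'b) mfps" where
  "- f = Abs_mfps (\<lambda>m. - mfps_nth f m)"

definition times_mfps :: "('a, 'b) mfps \<Rightarrow> ('a, 'b) mfps \<Rightarrow> ('a, 'b) mfps" where
  "f * g = Abs_mfps (\<lambda>m. \<Sum>(p, q)\<in>msplits m. mfps_nth f p * mfps_nth g q)"

lemma finite_submultisets: "finite {p. p \<subseteq># (m :: 'x multiset)}"
proof (induction m)
  case (add x m)
  have "{p. p \<subseteq># add_mset x m} \<subseteq> {p. p \<subseteq># m} \<union> add_mset x ` {p. p \<subseteq># m}"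
  proof
    fix p assume "p \<in> {p. p \<subseteq># add_mset x m}"
    then have p: "p \<subseteq># add_mset x m" by simp
    show "p \<in> {p. p \<subseteq># m} \<union> add_mset x ` {p. p \<subseteq># m}"
    proof (cases "x \<in># p")
      case True
      then obtain q where q: "p = add_mset x q" by (auto dest: multi_member_split)
      with p show ?thesis by auto
    next
      case False
      with p have "p \<subseteq># m"
        by (metis diff_single_trivial subset_eq_diff_conv add_mset_add_single)
      then show ?thesis by simp
    qed
  qed
  then show ?case using add.IH by (meson finite_UnI finite_imageI finite_subset)
qed simp

lemma finite_msplits [simp]: "finite (msplits m)"
proof (rule finite_subset)
  show "msplits m \<subseteq> {p. p \<subseteq># m} \<times> {p. p \<subseteq># m}"
    by (auto simp: msplits_def)
  show "finite ({p. p \<subseteq># m} \<times> {p. p \<subseteq># m})"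
    by (simp add: finite_submultisets)
qed

lemma mfps_zero_nth [simp]: "mfps_nth (0 :: ('a, 'b) mfps) m = 0"
  by (simp add: zero_mfps_def)

lemma mfps_one_nth [simp]: "mfps_nth (1 :: ('a, 'b) mfps) m = (if m = {#} then 1 else 0)"
  by (simp add: one_mfps_def)

lemma mfps_add_nth [simp]:
  "mfps_nth (f + g :: ('a, 'b) mfps) m = mfps_nth f m + mfps_nth g m"
  by (simp add: plus_mfps_def)

lemma mfps_diff_nth [simp]:
  "mfps_nth (f - g :: ('a, 'b) mfps) m = mfps_nth f m - mfps_nth g m"
  by (simp add: minus_mfps_def)

lemma mfps_uminus_nth [simp]: "mfps_nth (- f :: ('a, 'b) mfps) m = - mfps_nth f m"
  by (simp add: uminus_mfps_def)

lemma mfps_mult_nth: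
  "mfps_nth (f * g :: ('a, 'b) mfps) m = (\<Sum>(p, q)\<in>msplits m. mfps_nth f p * mfps_nth g q)"
  by (simp add: times_mfps_def)

instance
proof
  fix f g h :: "('a, 'b) mfps"
  show "f + g + h = f + (g + h)" "f + g = g + f" "0 + f = f" "- f + f = 0" "f - g = f + - g"
    by (auto intro!: mfps_ext simp: algebra_simps)
  show "(f + g) * h = f * h + g * h"
    by (rule mfps_ext)
       (simp add: mfps_mult_nth algebra_simps sum.distrib case_prod_unfold)
  show "(0 :: ('a, 'b) mfps) \<noteq> 1"
    by (auto simp: mfps_eq_iff)
  show "f * g = g * f"
  proof (rule mfps_ext)
    fix m
    show "mfps_nth (f * g) m = mfps_nth (g * f) m"
      unfolding mfps_mult_nth
      by (rule sum.reindex_bij_witness [where i = prod.swap and j = prod.swap])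
         (auto simp: msplits_def algebra_simps)
  qed
  show "1 * f = f"
  proof (rule mfps_ext)
    fix m
    have "mfps_nth (1 * f) m = (\<Sum>(p, q)\<in>{({#}, m)}. mfps_nth (1 :: ('a, 'b) mfps) p * mfps_nth f q)"
      unfolding mfps_mult_nth
      by (rule sum.mono_neutral_right [OF finite_msplits]) (auto simp: msplits_def split: if_splits)
    then show "mfps_nth (1 * f) m = mfps_nth f m" by simp
  qed
  show "f * g * h = f * (g * h)"
  proof (rule mfps_ext)
    fix m
    have "mfps_nth (f * g * h) m =
        (\<Sum>s\<in>msplits m. \<Sum>t\<in>msplits (fst s).
           mfps_nth f (fst t) * mfps_nth g (snd t) * mfps_nth h (snd s))"
      by (simp add: mfps_mult_nth case_prod_unfold sum_distrib_right)
    also have "\<dots> = (\<Sum>(s, t)\<in>Sigma (msplits m) (\<lambda>s. msplits (fst s)).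
           mfps_nth f (fst t) * mfps_nth g (snd t) * mfps_nth h (snd s))"
      by (subst sum.Sigma) auto
    also have "\<dots> = (\<Sum>(s, t)\<in>Sigma (msplits m) (\<lambda>s. msplits (snd s)).
           mfps_nth f (fst s) * (mfps_nth g (fst t) * mfps_nth h (snd t)))"
      by (rule sum.reindex_bij_witness
            [where i = "\<lambda>((p, _), (q, r)). ((p + q, r), (p, q))"
               and j = "\<lambda>((_, r), (p, q)). ((p, q + r), (q, r))"])
         (auto simp: msplits_def algebra_simps)
    also have "\<dots> = (\<Sum>s\<in>msplits m. \<Sum>t\<in>msplits (snd s).
           mfps_nth f (fst s) * (mfps_nth g (fst t) * mfps_nth h (snd t)))"
      by (subst sum.Sigma) auto
    also have "\<dots> = mfps_nth (f * (g * h)) m"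
      by (simp add: mfps_mult_nth case_prod_unfold sum_distrib_left)
    finally show "mfps_nth (f * g * h) m = mfps_nth (f * (g * h)) m" .
  qed
qed

end

definition mfps_const :: "'r::comm_ring_1 \<Rightarrow> ('x, 'r) mfps" where
  "mfps_const c = Abs_mfps (\<lambda>m. if m = {#} then c else 0)"

definition mfps_var :: "'x \<Rightarrow> ('x, 'r::comm_ring_1) mfps" where
  "mfps_var x = Abs_mfps (\<lambda>m. if m = {#x#} then 1 else 0)"

lemma mfps_const_mult_nth [simp]:
  fixes f :: "('x, 'r::comm_ring_1) mfps"
  shows "mfps_nth (mfps_const c * f) m = c * mfps_nth f m"
proof -
  have "mfps_nth (mfps_const c * f) m
      = (\<Sum>(p, q)\<in>{({#}, m)}. mfps_nth (mfps_const c :: ('x, 'r) mfps) p * mfps_nth f q)"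
    unfolding mfps_mult_nth
    by (rule sum.mono_neutral_right [OF finite_msplits])
       (auto simp: msplits_def mfps_const_def split: if_splits)
  then show ?thesis by (simp add: mfps_const_def)
qed


section \<open>Grammars and their formal derivatives\<close>

type_synonym ('x, 'r) grammar = "'x \<Rightarrow> ('x, 'r) mfps"

text \<open>
  \<open>D\<close> is a formal derivative of \<open>G\<close>: an \<open>'r\<close>-linear derivation with prescribed values on the
  letters.  A letter \<open>x\<close> without a rule has \<open>G x = 0\<close>.
\<close>

definition formal_derivative ::
  "('x, 'r::comm_ring_1) grammar \<Rightarrow> (('x, 'r) mfps \<Rightarrow> ('x, 'r) mfps) \<Rightarrow> bool" where
  "formal_derivative G D \<longleftrightarrow>
     (\<forall>f g. D (f + g) = D f + D g) \<and>
     (\<forall>c f. D (mfps_const c * f) = mfps_const c * D f) \<and>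
     (\<forall>f g. D (f * g) = D f * g + f * D g) \<and>
     (\<forall>x. D (mfps_var x) = G x)"

text \<open>
  Such a derivation exists whenever only finitely many letters have a rule, namely
  \<open>\<Sum>x. G x * \<partial>f/\<partial>x\<close>.
\<close>

definition mfps_pd :: "'x \<Rightarrow> ('x, 'r::comm_ring_1) mfps \<Rightarrow> ('x, 'r) mfps" where
  "mfps_pd x f = Abs_mfps (\<lambda>m. of_nat (count m x + 1) * mfps_nth f (add_mset x m))"

lemma mfps_pd_aux:
  fixes f g :: "('x, 'r::comm_ring_1) mfps"
  shows "(\<Sum>(p, q)\<in>msplits (add_mset x m). of_nat (count p x) * mfps_nth f p * mfps_nth g q)
       = mfps_nth (mfps_pd x f * g) m"
proof -
  have "(\<Sum>(p, q)\<in>msplits (add_mset x m). of_nat (count p x) * mfps_nth f p * mfps_nth g q)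
      = (\<Sum>(p, q)\<in>{(p, q) \<in> msplits (add_mset x m). x \<in># p}.
           of_nat (count p x) * mfps_nth f p * mfps_nth g q)"
    proof (rule sum.mono_neutral_right)
    show "\<forall>s\<in>msplits (add_mset x m) - {(p, q) \<in> msplits (add_mset x m). x \<in># p}.
        (case s of (p, q) \<Rightarrow> of_nat (count p x) * mfps_nth f p * mfps_nth g q) = 0"
    proof
      fix s assume "s \<in> msplits (add_mset x m) - {(p, q) \<in> msplits (add_mset x m). x \<in># p}"
      then have "count (fst s) x = 0" by (auto simp: not_in_iff)
      then show "(case s of (p, q) \<Rightarrow> of_nat (count p x) * mfps_nth f p * mfps_nth g q) = 0"
        by (simp add: case_prod_unfold)
    qed
  qed auto
  also have "\<dots> = (\<Sum>(p, q)\<in>msplits m.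
           of_nat (count p x + 1) * mfps_nth f (add_mset x p) * mfps_nth g q)"
    by (rule sum.reindex_bij_witness
          [where i = "\<lambda>(p, q). (add_mset x p, q)" and j = "\<lambda>(p, q). (p - {#x#}, q)"])
       (auto simp: msplits_def dest!: multi_member_split)
  finally show ?thesis by (simp add: mfps_mult_nth mfps_pd_def)
qed

lemma mfps_pd_mult: "mfps_pd x (f * g) = mfps_pd x f * g + f * mfps_pd x g"
proof (rule mfps_ext)
  fix m
  have "mfps_nth (mfps_pd x (f * g)) m
      = (\<Sum>(p, q)\<in>msplits (add_mset x m).
           of_nat (count (add_mset x m) x) * (mfps_nth f p * mfps_nth g q))"
    by (simp add: mfps_pd_def mfps_mult_nth sum_distrib_left case_prod_unfold)
  also have "\<dots> = (\<Sum>(p, q)\<in>msplits (add_mset x m).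
           of_nat (count p x) * mfps_nth f p * mfps_nth g q
           + of_nat (count q x) * mfps_nth g q * mfps_nth f p)"
  proof (intro sum.cong refl, clarify)
    fix p q assume "(p, q) \<in> msplits (add_mset x m)"
    then have "count (add_mset x m) x = count p x + count q x"
      by (metis (mono_tags, lifting) case_prodD count_union mem_Collect_eq msplits_def)
    then show "of_nat (count (add_mset x m) x) * (mfps_nth f p * mfps_nth g q)
      = of_nat (count p x) * mfps_nth f p * mfps_nth g q
        + of_nat (count q x) * mfps_nth g q * mfps_nth f p"
      by (simp only: of_nat_add) (simp add: algebra_simps)
  qed
  also have "\<dots> = mfps_nth (mfps_pd x f * g) m
      + (\<Sum>(p, q)\<in>msplits (add_mset x m). of_nat (count q x) * mfps_nth g q * mfps_nth f p)"
    by (simp add: sum.distrib case_prod_unfold flip: mfps_pd_aux)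
  also have "(\<Sum>(p, q)\<in>msplits (add_mset x m). of_nat (count q x) * mfps_nth g q * mfps_nth f p)
      = (\<Sum>(p, q)\<in>msplits (add_mset x m). of_nat (count p x) * mfps_nth g p * mfps_nth f q)"
    by (rule sum.reindex_bij_witness [where i = prod.swap and j = prod.swap])
       (auto simp: msplits_def algebra_simps)
  also have "\<dots> = mfps_nth (f * mfps_pd x g) m"
    by (simp add: mfps_pd_aux mult.commute [of f])
  finally show "mfps_nth (mfps_pd x (f * g)) m = mfps_nth (mfps_pd x f * g + f * mfps_pd x g) m"
    by simp
qed

lemma mfps_pd_var: "mfps_pd x (mfps_var y) = (if x = y then 1 else 0)"
  by (auto intro!: mfps_ext simp: mfps_pd_def mfps_var_def)

lemma formal_derivative_exists:
  fixes G :: "('x, 'r::comm_ring_1) grammar"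
  assumes fin: "finite {x. G x \<noteq> 0}"
  shows "\<exists>D. formal_derivative G D"
proof -
  define S where "S = {x. G x \<noteq> 0}"
  define D where "D f = (\<Sum>x\<in>S. G x * mfps_pd x f)" for f
  have add: "mfps_pd x (f + g) = mfps_pd x f + mfps_pd x g" for x and f g :: "('x, 'r) mfps"
    by (rule mfps_ext) (simp add: mfps_pd_def algebra_simps)
  have scale: "mfps_pd x (mfps_const c * f) = mfps_const c * mfps_pd x f"
    for x c and f :: "('x, 'r) mfps"
    by (rule mfps_ext) (simp add: mfps_pd_def mult.left_commute)
  have "D (f + g) = D f + D g" for f g
    by (simp add: D_def add distrib_left sum.distrib)
  moreover have "D (mfps_const c * f) = mfps_const c * D f" for c f
    by (simp add: D_def scale sum_distrib_left mult.left_commute)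
  moreover have "D (f * g) = D f * g + f * D g" for f g
    by (simp add: D_def mfps_pd_mult sum_distrib_left sum_distrib_right sum.distrib algebra_simps)
  moreover have "D (mfps_var y) = G y" for y
  proof -
    have "D (mfps_var y) = (\<Sum>x\<in>S. if x = y then G x else 0)"
      by (auto simp: D_def mfps_pd_var intro!: sum.cong)
    also have "\<dots> = G y"
      using fin by (auto simp: S_def)
    finally show ?thesis .
  qed
  ultimately show ?thesis
    unfolding formal_derivative_def by blast
qed


section \<open>The Jacobi-Stirling numbers and grammars\<close>

text \<open>Scalars are polynomials in \<open>z\<close> over the rationals.\<close>

abbreviation zvar :: "rat poly" where
  "zvar \<equiv> [:0, 1:]"

text \<open>
  In \<open>rat poly poly\<close> the inner indeterminate is \<open>z\<close> and the outer one is \<open>x\<close>, so each factor below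
  is \<open>x + i * (z + i)\<close>.
\<close>

definition Jc :: "nat \<Rightarrow> nat \<Rightarrow> rat poly" where
  "Jc n k = poly.coeff (\<Prod>i<n. [:of_nat i * (zvar + of_nat i), 1:]) k"

datatype letter = LA | LB nat

fun JS_grammar :: "nat \<Rightarrow> (letter, rat poly) grammar" where
  "JS_grammar k LA = mfps_const ((of_nat k - 1) * (of_nat k - 1 + zvar)) * mfps_var LA"
| "JS_grammar k (LB j) = (if j < k then mfps_var (LB (Suc j)) else 0)"

lemma JS_grammar_derivative_exists: "\<exists>D. formal_derivative (JS_grammar k) D"
proof (rule formal_derivative_exists, rule finite_subset)
  show "{x. JS_grammar k x \<noteq> 0} \<subseteq> insert LA (LB ` {..<k})"
  proof
    fix x assume "x \<in> {x. JS_grammar k x \<noteq> 0}"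
    then show "x \<in> insert LA (LB ` {..<k})" by (cases x) (auto split: if_splits)
  qed
qed simp

end

theory Submission
  imports Defs
begin

text \<open>
  Applying \<open>D\<^sub>n\<^sub>+\<^sub>1\<close> to \<open>a b\<^sub>k\<close> with \<open>k \<le> n\<close> gives \<open>n (n + z) a b\<^sub>k + a b\<^sub>k\<^sub>+\<^sub>1\<close>, which is exactly how
  multiplication by \<open>x + n (z + n)\<close> acts on \<open>x\<^sup>k\<close>.  So the coefficients on both sides obey the same
  recurrence; the induction starts at \<open>n = 0\<close>, where the sum has to include the term \<open>k = 0\<close>.
\<close>

lemma mfps_const_0 [simp]: "mfps_const 0 = 0"
  by (rule mfps_ext) (simp add: mfps_const_def)

lemma mfps_const_1 [simp]: "mfps_const 1 = 1"
  by (rule mfps_ext) (simp add: mfps_const_def)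

lemma mfps_const_add: "mfps_const (c + d) = mfps_const c + mfps_const d"
  by (rule mfps_ext) (simp add: mfps_const_def)

lemma mfps_const_mult: "mfps_const (c * d) = mfps_const c * mfps_const d"
  \<comment> \<open>The product must be evaluated by \<open>mfps_const_mult_nth\<close> before
    unfolding \<open>mfps_const\<close> destroys its left-hand side.\<close>
  by (rule mfps_ext) (simp, simp add: mfps_const_def)

lemma formal_derivativeD:
  assumes "formal_derivative G D"
  shows "D (f + g) = D f + D g"
    and "D (mfps_const c * f) = mfps_const c * D f"
    and "D (f * g) = D f * g + f * D g"
    and "D (mfps_var x) = G x"
  using assms unfolding formal_derivative_def by blast+

lemma formal_derivative_sum:
  assumes D: "formal_derivative G D"
  shows "D (sum f A) = (\<Sum>i\<in>A. D (f i))"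
proof -
  \<comment> \<open>Settles the empty sum and the sum over an infinite set, which is 0 by
    convention.\<close>
  have "D 0 = 0"
    using formal_derivativeD(1)[OF D, of 0 0] by simp
  then show ?thesis
    by (induction A rule: infinite_finite_induct) (simp_all add: formal_derivativeD(1)[OF D])
qed

lemma Jc_0: "Jc 0 k = (if k = 0 then 1 else 0)"
  by (simp add: Jc_def)

lemma Jc_Suc_0: "Jc (Suc n) 0 = of_nat n * (of_nat n + zvar) * Jc n 0"
  by (simp add: Jc_def algebra_simps)

lemma Jc_Suc_Suc: "Jc (Suc n) (Suc k) = Jc n k + of_nat n * (of_nat n + zvar) * Jc n (Suc k)"
  by (simp add: Jc_def algebra_simps)

text \<open>The factor for i = 0 of the defining product is x itself.\<close>

lemma Jc_pos_0: "n \<ge> 1 \<Longrightarrow> Jc n 0 = 0"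
  by (induction n rule: nat_induct_at_least) (simp_all add: Jc_Suc_0)

text \<open>The defining product has n linear factors, hence degree n in x.\<close>

lemma Jc_eq_0: "n < k \<Longrightarrow> Jc n k = 0"
proof (induction n arbitrary: k)
  case (Suc n)
  then show ?case by (cases k) (simp_all add: Jc_Suc_Suc)
qed (simp add: Jc_0)

lemma JS_derivative_sum:
  fixes c :: "nat \<Rightarrow> rat poly"
  assumes D: "formal_derivative (JS_grammar (Suc n)) D"
  shows "D (mfps_var LA * (\<Sum>k\<le>n. mfps_const (c k) * mfps_var (LB k)))
       = mfps_var LA * (mfps_const (of_nat n * (of_nat n + zvar))
                          * (\<Sum>k\<le>n. mfps_const (c k) * mfps_var (LB k))
                        + (\<Sum>k\<le>n. mfps_const (c k) * mfps_var (LB (Suc k))))"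
proof -
  \<comment> \<open>As \<open>k \<le> n\<close> means \<open>k < Suc n\<close>, every letter in the
    sum has a rule, and none is sent to 0.\<close>
  have "D (\<Sum>k\<le>n. mfps_const (c k) * mfps_var (LB k))
      = (\<Sum>k\<le>n. mfps_const (c k) * mfps_var (LB (Suc k)))"
    by (simp add: formal_derivative_sum[OF D] formal_derivativeD(2,4)[OF D])
  then show ?thesis
    by (simp add: formal_derivativeD(3,4)[OF D] algebra_simps)
qed

lemma sum_Jc_Suc:
  "(\<Sum>k\<le>Suc n. mfps_const (Jc (Suc n) k) * g k)
     = mfps_const (of_nat n * (of_nat n + zvar)) * (\<Sum>k\<le>n. mfps_const (Jc n k) * g k)
       + (\<Sum>k\<le>n. mfps_const (Jc n k) * g (Suc k))" (is "_ = mfps_const ?c * ?S + ?T")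
proof -
  \<comment> \<open>The term for 0 is split off because the recurrence has no
    \<open>Jc n (k - 1)\<close> part there.\<close>
  have "(\<Sum>k\<le>Suc n. mfps_const (Jc (Suc n) k) * g k)
      = mfps_const ?c * (mfps_const (Jc n 0) * g 0
          + (\<Sum>k\<le>n. mfps_const (Jc n (Suc k)) * g (Suc k))) + ?T"
    by (simp only: sum.atMost_Suc_shift Jc_Suc_0 Jc_Suc_Suc mfps_const_add mfps_const_mult
        distrib_right distrib_left sum.distrib sum_distrib_left mult.assoc add_ac)
  also have "mfps_const (Jc n 0) * g 0 + (\<Sum>k\<le>n. mfps_const (Jc n (Suc k)) * g (Suc k))
      = (\<Sum>k\<le>Suc n. mfps_const (Jc n k) * g k)"
    by (simp only: sum.atMost_Suc_shift)
  \<comment> \<open>The top term vanishes, since \<open>Jc n (Suc n) = 0\<close>.\<close>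
  also have "\<dots> = ?S"
    by (simp add: Jc_eq_0)
  finally show ?thesis .
qed

text \<open>\<open>fold\<close> applies the head of the list first, so \<open>D 1\<close> acts
  innermost and each induction step adds \<open>D (Suc n)\<close> on the outside.\<close>

lemma fold_JS_derivatives:
  fixes D :: "nat \<Rightarrow> (letter, rat poly) mfps \<Rightarrow> (letter, rat poly) mfps"
  assumes "\<And>k. k \<ge> 1 \<Longrightarrow> formal_derivative (JS_grammar k) (D k)"
  shows "fold D [1..<Suc n] (mfps_var LA * mfps_var (LB 0))
       = mfps_var LA * (\<Sum>k\<le>n. mfps_const (Jc n k) * mfps_var (LB k))"
proof (induction n)
  case 0
  show ?case by (simp add: Jc_0)
next
  case (Suc n)
  have "fold D [1..<Suc (Suc n)] (mfps_var LA * mfps_var (LB 0))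
      = D (Suc n) (fold D [1..<Suc n] (mfps_var LA * mfps_var (LB 0)))"
    by simp
  also have "\<dots> = mfps_var LA * (\<Sum>k\<le>Suc n. mfps_const (Jc (Suc n) k) * mfps_var (LB k))"
    unfolding Suc.IH sum_Jc_Suc by (rule JS_derivative_sum) (simp add: assms)
  finally show ?case .
qed

theorem theorem3:
  fixes D :: "nat \<Rightarrow> (letter, rat poly) mfps \<Rightarrow> (letter, rat poly) mfps" and n :: nat
  assumes "\<And>k. k \<ge> 1 \<Longrightarrow> formal_derivative (JS_grammar k) (D k)"
    and "n \<ge> 1"
  shows "fold D [1..<Suc n] (mfps_var LA * mfps_var (LB 0))
       = mfps_var LA * (\<Sum>k=1..n. mfps_const (Jc n k) * mfps_var (LB k))"
proof -
  have "(\<Sum>k\<le>n. mfps_const (Jc n k) * mfps_var (LB k))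
      = (\<Sum>k=1..n. mfps_const (Jc n k) * mfps_var (LB k))"
    \<comment> \<open>Here \<open>n \<ge> 1\<close> removes the term for 0; at n = 0 it would be
      \<open>mfps_var (LB 0)\<close>.\<close>
    using \<open>n \<ge> 1\<close> by (simp add: atMost_atLeast0 sum.atLeast_Suc_atMost Jc_pos_0)
  with fold_JS_derivatives[OF assms(1)] show ?thesis
    by simp
qed

end
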